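(* Let $V$ be a finite-dimensional complex vector space and $T\in\operatorname{End}(V)$. For each eigenvalue $\lambda$ of $T$, let $B_\lambda=\{i^\lambda_1<i^\lambda_2<\cdots\}$ be the set of sizes of Jordan blocks of $T$ with eigenvalue $\lambda$, let $(\Delta^\lambda_k)_k$ be the associated sequence of Jordan block increments, let $m^\lambda_{i_k}$ be the multiplicity (number) of Jordan blocks of size $i^\lambda_k$ with eigenvalue $\lambda$, and let $M^\lambda_n=\sum_{k\ge n}m^\lambda_{i_k}$ be the tail sums of these multiplicities. Define the polynomial $$f_\lambda(x)=\prod_{k}\left(\sum_{i=0}^{\Delta^\lambda_k}x^{iM^\lambda_k}\right),$$ where the product is over $1\le k\le\#B_\lambda$. Then for every $n$, the number of orbits of dimension $n$ of the centralizer group $C(T)$ on $V$ is the coefficient of $x^n$ in the generating function $$\prod_{\lambda\in\mathrm{Spec}(T)}f_\lambda(x).$$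
   Context: $C(T)=\{U\in\operatorname{GL}(V): UT=TU\}$, acting on $V$; $\mathrm{Spec}(T)$ is the set of distinct eigenvalues of $T$. The block increments for $\lambda$ are $\Delta^\lambda_1=i^\lambda_1$ and $\Delta^\lambda_k=i^\lambda_k-i^\lambda_{k-1}$ for $1<k\le\#B_\lambda$. Each $C(T)$-orbit is an open dense subset of a linear subspace of $V$ (its closure); the dimension of the orbit is the complex dimension of that subspace. *)

theory Defs
  imports
    "HOL-Analysis.Analysis"
    "HOL-Algebra.Group_Action"
    "HOL-Computational_Algebra.Polynomial"
    "Jordan_Normal_Form.Jordan_Normal_Form_Existence"
begin

type_synonym 'v cscale = "complex \<Rightarrow> 'v \<Rightarrow> 'v"

text \<open>
  A complex vector space is a type \<open>'v\<close> with a scalar multiplication \<open>scl\<close> satisfying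
  \<^locale>\<open>vector_space\<close>; the constants below take \<open>scl\<close> explicitly.
\<close>

definition centralizer_group :: "'v::ab_group_add cscale \<Rightarrow> ('v \<Rightarrow> 'v) \<Rightarrow> ('v \<Rightarrow> 'v) monoid" where
  "centralizer_group scl T =
     \<lparr>carrier = {U. Vector_Spaces.linear scl scl U \<and> bij U \<and> U \<circ> T = T \<circ> U},
      monoid.mult = (\<circ>), one = id\<rparr>"

definition centralizer_orbits :: "'v::ab_group_add cscale \<Rightarrow> ('v \<Rightarrow> 'v) \<Rightarrow> 'v set set" where
  "centralizer_orbits scl T = orbits (centralizer_group scl T) UNIV (\<lambda>U. U)"

text \<open>
  The coarsest topology making all linear functionals continuous. On a finite-dimensional
  space this is the usual (Euclidean) topology.
\<close>

definition standard_topology :: "'v::ab_group_add cscale \<Rightarrow> 'v topology" where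
  "standard_topology scl =
     topology_generated_by {f -` S |f S. Vector_Spaces.linear scl (*) f \<and> open (S :: complex set)}"

text \<open>The closure of a centralizer orbit is a linear subspace, so \<open>dim\<close> is its dimension.\<close>

definition orbit_dim :: "'v::ab_group_add cscale \<Rightarrow> 'v set \<Rightarrow> nat" where
  "orbit_dim scl X = vector_space.dim scl (standard_topology scl closure_of X)"

definition Spec :: "'v::ab_group_add cscale \<Rightarrow> ('v \<Rightarrow> 'v) \<Rightarrow> complex set" where
  "Spec scl T = {\<mu>. \<exists>v. v \<noteq> 0 \<and> T v = scl \<mu> v}"

definition is_ordered_basis :: "'v::ab_group_add cscale \<Rightarrow> 'v list \<Rightarrow> bool" where
  "is_ordered_basis scl bs \<longleftrightarrow>
     distinct bs \<and> \<not> Modules.module.dependent scl (set bs) \<and>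
     Modules.module.span scl (set bs) = UNIV"

definition matrix_wrt :: "'v::ab_group_add cscale \<Rightarrow> 'v list \<Rightarrow> ('v \<Rightarrow> 'v) \<Rightarrow> complex mat \<Rightarrow> bool" where
  "matrix_wrt scl bs T A \<longleftrightarrow>
     A \<in> carrier_mat (length bs) (length bs) \<and>
     (\<forall>j<length bs. T (bs ! j) = (\<Sum>i<length bs. scl (A $$ (i, j)) (bs ! i)))"

text \<open>
  The list of all Jordan blocks of \<open>T\<close>, as pairs (size, eigenvalue) with repetitions. It is
  determined by \<open>T\<close> only up to the order of the entries; the choice of order does not affect
  the notions derived from it below.
\<close>

definition jordan_blocks :: "'v::ab_group_add cscale \<Rightarrow> ('v \<Rightarrow> 'v) \<Rightarrow> (nat \<times> complex) list" where
  "jordan_blocks scl T =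
     (SOME n_as. \<exists>bs A. is_ordered_basis scl bs \<and> matrix_wrt scl bs T A \<and> jordan_nf A n_as)"

definition block_sizes :: "'v::ab_group_add cscale \<Rightarrow> ('v \<Rightarrow> 'v) \<Rightarrow> complex \<Rightarrow> nat set" where
  "block_sizes scl T \<mu> = {i. (i, \<mu>) \<in> set (jordan_blocks scl T)}"

definition block_mult :: "'v::ab_group_add cscale \<Rightarrow> ('v \<Rightarrow> 'v) \<Rightarrow> complex \<Rightarrow> nat \<Rightarrow> nat" where
  "block_mult scl T \<mu> i = count_list (jordan_blocks scl T) (i, \<mu>)"

text \<open>
  The index \<open>k\<close> starts at 1: \<open>nth_size scl T \<mu> k\<close> is the \<open>k\<close>-th smallest block size, meaningful
  for \<open>1 \<le> k \<le> card (block_sizes scl T \<mu>)\<close>.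
\<close>

definition nth_size :: "'v::ab_group_add cscale \<Rightarrow> ('v \<Rightarrow> 'v) \<Rightarrow> complex \<Rightarrow> nat \<Rightarrow> nat" where
  "nth_size scl T \<mu> k = sorted_list_of_set (block_sizes scl T \<mu>) ! (k - 1)"

definition increment :: "'v::ab_group_add cscale \<Rightarrow> ('v \<Rightarrow> 'v) \<Rightarrow> complex \<Rightarrow> nat \<Rightarrow> nat" where
  "increment scl T \<mu> k =
     (if k = 1 then nth_size scl T \<mu> 1 else nth_size scl T \<mu> k - nth_size scl T \<mu> (k - 1))"

definition tail_mult :: "'v::ab_group_add cscale \<Rightarrow> ('v \<Rightarrow> 'v) \<Rightarrow> complex \<Rightarrow> nat \<Rightarrow> nat" where
  "tail_mult scl T \<mu> n =
     (\<Sum>k = n..card (block_sizes scl T \<mu>). block_mult scl T \<mu> (nth_size scl T \<mu> k))"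

definition eigen_poly :: "'v::ab_group_add cscale \<Rightarrow> ('v \<Rightarrow> 'v) \<Rightarrow> complex \<Rightarrow> nat poly" where
  "eigen_poly scl T \<mu> =
     (\<Prod>k = 1..card (block_sizes scl T \<mu>).
        \<Sum>i = 0..increment scl T \<mu> k. monom 1 (i * tail_mult scl T \<mu> k))"

end

theory Submission
  imports Defs
begin

text \<open>
  In a Jordan basis \<open>e b j\<close> (block \<open>b\<close>, \<open>j < sz b\<close>) the height \<open>ht v b\<close> of a vector is one more than
  the largest index occurring in its \<open>b\<close>-component. A map commuting with \<open>T\<close> between blocks of the
  same eigenvalue from size \<open>m\<close> to size \<open>n\<close> lowers the height by at least \<open>m - n\<close> (truncated), so the
  largest height reachable in block \<open>b\<close> is \<open>hull_ht v b = Max\<^sub>c (ht v c - (sz c - sz b))\<close>. Two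
  vectors are in the same orbit iff their hull heights agree, and the orbit spans
  \<open>span {e b j | j < hull_ht v b}\<close>, of dimension \<open>\<Sum>b. hull_ht v b\<close>. The functions occurring as hull
  heights are those that, along the block sizes of each eigenvalue, increase by at most the
  increments of the sizes. Raising the \<open>k\<close>-th increment by one raises the heights of all blocks of
  at least the \<open>k\<close>-th size, which accounts for the exponents \<open>i M\<^sub>k\<close>.
\<close>

section \<open>Coordinates in a Jordan basis\<close>

lemma mem_centralizer_group_iff:
  "U \<in> carrier (centralizer_group scl T) \<longleftrightarrow>
     Vector_Spaces.linear scl scl U \<and> bij U \<and> U \<circ> T = T \<circ> U"
  by (simp add: centralizer_group_def)

text \<open>A Jordan basis with abstract block indices, so that equal blocks stay distinguishable.
  \<open>e b 0\<close> is the eigenvector of block \<open>b\<close>, and \<open>T - ev b\<close>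
  lowers the second index by one.\<close>

locale jordan_space = vector_space scl
  for scl :: "complex \<Rightarrow> 'v::ab_group_add \<Rightarrow> 'v" (infixr "*\<^sub>C" 75) +
  fixes T :: "'v \<Rightarrow> 'v" and J :: "'b set" and sz :: "'b \<Rightarrow> nat" and ev :: "'b \<Rightarrow> complex"
    and e :: "'b \<Rightarrow> nat \<Rightarrow> 'v"
  assumes linear_T: "Vector_Spaces.linear scl scl T"
    and finite_J: "finite J"
    and inj_e: "inj_on (case_prod e) (Sigma J (\<lambda>b. {..<sz b}))"
    and independent_e: "independent (case_prod e ` Sigma J (\<lambda>b. {..<sz b}))"
    and span_e: "span (case_prod e ` Sigma J (\<lambda>b. {..<sz b})) = UNIV"
    and T_e: "b \<in> J \<Longrightarrow> j < sz b \<Longrightarrow>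
                T (e b j) = ev b *\<^sub>C e b j + (if j = 0 then 0 else e b (j - 1))"
begin

abbreviation boxes :: "('b \<times> nat) set" where
  "boxes \<equiv> Sigma J (\<lambda>b. {..<sz b})"

abbreviation C :: "('v \<Rightarrow> 'v) set" where
  "C \<equiv> carrier (centralizer_group scl T)"

text \<open>Extending by zero outside the boxes makes index shifts total: \<open>T\<close> then acts
  in coordinates without a special case at the top of a block.\<close>

definition coord :: "'v \<Rightarrow> 'b \<Rightarrow> nat \<Rightarrow> complex" where
  "coord v b j =
     (if b \<in> J \<and> j < sz b then representation (case_prod e ` boxes) v (e b j) else 0)"

definition vec_of :: "('b \<Rightarrow> nat \<Rightarrow> complex) \<Rightarrow> 'v" where
  "vec_of f = (\<Sum>(b, j)\<in>boxes. f b j *\<^sub>C e b j)"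

lemma finite_boxes: "finite boxes"
  using finite_J by auto

lemma finite_dimensional: "finite_dimensional_vector_space scl (case_prod e ` boxes)"
  by unfold_locales (use finite_boxes independent_e span_e in auto)

lemma linear_coord: "Vector_Spaces.linear scl (*) (\<lambda>v. coord v b j)"
proof (cases "b \<in> J \<and> j < sz b")
  case True
  then show ?thesis
    using linear_representation[OF independent_e span_e] by (simp add: coord_def)
next
  case False
  then have "(\<lambda>v. coord v b j) = (\<lambda>v. 0)" by (auto simp: coord_def)
  moreover have "Vector_Spaces.linear scl (*) (\<lambda>v. 0)"
    by unfold_locales (auto simp: algebra_simps)
  ultimately show ?thesis by simp
qed

lemma coord_add: "coord (v + w) b j = coord v b j + coord w b j"
  using linear_coord[THEN module_hom_linearI] by (rule module_hom.add)

lemma coord_scale: "coord (c *\<^sub>C v) b j = c * coord v b j"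
  using linear_coord[THEN module_hom_linearI] by (rule module_hom.scale)

lemma coord_zero: "coord 0 b j = 0"
  using linear_coord[THEN module_hom_linearI] by (rule module_hom.zero)

lemma coord_sum: "coord (sum f A) b j = (\<Sum>a\<in>A. coord (f a) b j)"
  using linear_coord[THEN module_hom_linearI] by (rule module_hom.sum)

lemma coord_outside: "\<not> (b \<in> J \<and> j < sz b) \<Longrightarrow> coord v b j = 0"
  unfolding coord_def by (rule if_not_P)

lemma coord_e:
  assumes "b \<in> J" "j < sz b"
  shows "coord (e b j) c i = (if c = b \<and> i = j then 1 else 0)"
proof (cases "c \<in> J \<and> i < sz c")
  case True
  have "e b j \<in> case_prod e ` boxes" using assms by force
  then have "representation (case_prod e ` boxes) (e b j) = (\<lambda>v. if v = e b j then 1 else 0)"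
    by (rule representation_basis[OF independent_e])
  moreover have "e c i = e b j \<longleftrightarrow> c = b \<and> i = j"
    using inj_onD[OF inj_e, of "(c, i)" "(b, j)"] True assms by auto
  ultimately show ?thesis using True by (simp add: coord_def)
qed (use assms in \<open>auto simp: coord_def\<close>)

lemma vec_of_coord: "vec_of (coord v) = v"
proof -
  have "(\<Sum>x\<in>case_prod e ` boxes. representation (case_prod e ` boxes) v x *\<^sub>C x) = v"
    by (rule sum_representation_eq) (use independent_e span_e finite_boxes in auto)
  then have "(\<Sum>(b, j)\<in>boxes. representation (case_prod e ` boxes) v (e b j) *\<^sub>C e b j) = v"
    by (subst (asm) sum.reindex[OF inj_e]) (simp add: o_def case_prod_beta)
  then show ?thesis
    unfolding vec_of_def by (smt (verit) SigmaE case_prod_conv coord_def lessThan_iff sum.cong)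
qed

lemma coord_vec_of:
  assumes "\<And>b j. \<not> (b \<in> J \<and> j < sz b) \<Longrightarrow> f b j = 0"
  shows "coord (vec_of f) b j = f b j"
proof -
  have "coord (vec_of f) b j =
      (\<Sum>p\<in>boxes. f (fst p) (snd p) * coord (e (fst p) (snd p)) b j)"
    by (simp add: vec_of_def coord_sum case_prod_beta coord_scale)
  also have "\<dots> = (\<Sum>p\<in>boxes. if p = (b, j) then f b j else 0)"
    by (intro sum.cong) (auto simp: coord_e split: if_splits)
  also have "\<dots> = f b j"
    using finite_boxes assms[of b j] by auto
  finally show ?thesis .
qed

lemma coord_eqI:
  assumes "\<And>b j. b \<in> J \<Longrightarrow> coord v b j = coord w b j"
  shows "v = w"
proof -
  have "coord v = coord w"
    using assms coord_outside by (intro ext) metis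
  then show ?thesis by (metis vec_of_coord)
qed

lemma coord_T:
  assumes "b \<in> J"
  shows "coord (T v) b j = ev b * coord v b j + coord v b (Suc j)"
proof -
  interpret T: Vector_Spaces.linear scl scl T by (rule linear_T)
  have "T v = T (vec_of (coord v))" by (simp add: vec_of_coord)
  also have "\<dots> = (\<Sum>p\<in>boxes. coord v (fst p) (snd p) *\<^sub>C T (e (fst p) (snd p)))"
    by (simp add: vec_of_def T.sum T.scale case_prod_beta)
  also have "\<dots> = (\<Sum>p\<in>boxes. coord v (fst p) (snd p) *\<^sub>C
      (ev (fst p) *\<^sub>C e (fst p) (snd p) + (if snd p = 0 then 0 else e (fst p) (snd p - 1))))"
    by (intro sum.cong) (auto simp: T_e)
  finally have "coord (T v) b j = (\<Sum>p\<in>boxes. coord v (fst p) (snd p) *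
      (ev (fst p) * coord (e (fst p) (snd p)) b j +
       (if snd p = 0 then 0 else coord (e (fst p) (snd p - 1)) b j)))"
    by (simp add: coord_sum coord_scale coord_add coord_zero if_distrib[of "\<lambda>v. coord v b j"] cong: if_cong)
  also have "\<dots> = (\<Sum>p\<in>boxes. (if p = (b, j) then ev b * coord v b j else 0) +
      (if p = (b, Suc j) then coord v b (Suc j) else 0))"
    by (intro sum.cong) (auto simp: coord_e split: if_splits)
  also have "\<dots> = ev b * coord v b j + coord v b (Suc j)"
    using finite_boxes coord_outside[of b j v] coord_outside[of b "Suc j" v]
    by (auto simp: sum.distrib)
  finally show ?thesis .
qed

lemma linearI_coord:
  assumes "\<And>v w b j. b \<in> J \<Longrightarrow> coord (U (v + w)) b j = coord (U v) b j + coord (U w) b j"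
    and "\<And>c v b j. b \<in> J \<Longrightarrow> coord (U (c *\<^sub>C v)) b j = c * coord (U v) b j"
  shows "Vector_Spaces.linear scl scl U"
  by unfold_locales (auto intro!: coord_eqI simp: assms coord_add coord_scale)

text \<open>Commutation is tested in coordinates, in the form given by \<open>coord_T\<close>.
  Bijectivity follows from a trivial kernel because the space is finite-dimensional.\<close>

lemma centralizerI:
  assumes "\<And>v w b j. b \<in> J \<Longrightarrow> coord (U (v + w)) b j = coord (U v) b j + coord (U w) b j"
    and "\<And>c v b j. b \<in> J \<Longrightarrow> coord (U (c *\<^sub>C v)) b j = c * coord (U v) b j"
    and commute: "\<And>v b j. b \<in> J \<Longrightarrow>
      coord (U (T v)) b j = ev b * coord (U v) b j + coord (U v) b (Suc j)"
    and inj: "\<And>v. U v = 0 \<Longrightarrow> v = 0"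
  shows "U \<in> C"
proof -
  interpret finite_dimensional_vector_space scl "case_prod e ` boxes" by (rule finite_dimensional)
  have lin: "Vector_Spaces.linear scl scl U" by (rule linearI_coord) (use assms in auto)
  interpret U: Vector_Spaces.linear scl scl U by (rule lin)
  have "inj U" using inj U.inj_iff_eq_0 by blast
  moreover have "surj U" using linear_inj_imp_surj lin \<open>inj U\<close> by blast
  moreover have "U (T v) = T (U v)" for v
    by (rule coord_eqI) (simp add: coord_T commute)
  ultimately show ?thesis
    using lin by (auto simp: mem_centralizer_group_iff bij_def)
qed

lemma C_inv: "U \<in> C \<Longrightarrow> inv_into UNIV U \<in> C"
proof -
  assume "U \<in> C"
  then have lin: "Vector_Spaces.linear scl scl U" and bij: "bij U" and comm: "U \<circ> T = T \<circ> U"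
    by (auto simp: mem_centralizer_group_iff)
  interpret U: Vector_Spaces.linear scl scl U by (rule lin)
  have i: "U (inv_into UNIV U x) = x" "inv_into UNIV U (U x) = x" for x
    using bij by (auto simp: bij_is_surj surj_f_inv_f bij_is_inj inv_f_f)
  have "Vector_Spaces.linear scl scl (inv_into UNIV U)"
    by unfold_locales (metis i U.add, metis i U.scale)
  moreover have "inv_into UNIV U \<circ> T = T \<circ> inv_into UNIV U"
  proof
    fix x
    have "U (T (inv_into UNIV U x)) = T x" using comm i by (metis comp_apply)
    then show "(inv_into UNIV U \<circ> T) x = (T \<circ> inv_into UNIV U) x" using i by (metis comp_apply)
  qed
  ultimately show ?thesis
    using bij_imp_bij_inv[OF bij] by (simp add: mem_centralizer_group_iff)
qed

lemma C_comp: "U \<in> C \<Longrightarrow> W \<in> C \<Longrightarrow> U \<circ> W \<in> C"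
  by (auto simp: mem_centralizer_group_iff bij_comp fun_eq_iff intro: Vector_Spaces.linear_compose)


section \<open>Hull heights and centralizer orbits\<close>

definition ht :: "'v \<Rightarrow> 'b \<Rightarrow> nat" where
  "ht v b = (LEAST k. \<forall>j\<ge>k. coord v b j = 0)"

text \<open>For these \<open>h\<close> the span of all \<open>e b j\<close> with
  \<open>j < h b\<close> is stable under the centralizer. Truncated subtraction joins two bounds:
  heights do not decrease with the size, and do not grow faster than it. The value 0 outside
  \<open>J\<close> lets such functions be counted.\<close>

definition admissible :: "('b \<Rightarrow> nat) \<Rightarrow> bool" where
  "admissible h \<longleftrightarrow> (\<forall>b\<in>J. h b \<le> sz b) \<and>
     (\<forall>b\<in>J. \<forall>c\<in>J. ev c = ev b \<longrightarrow> h c - (sz c - sz b) \<le> h b) \<and> (\<forall>b. b \<notin> J \<longrightarrow> h b = 0)"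

text \<open>The least admissible function above \<open>ht v\<close>; for \<open>b\<close> in
  \<open>J\<close> the maximum includes \<open>b\<close> itself.\<close>

definition hull_ht :: "'v \<Rightarrow> 'b \<Rightarrow> nat" where
  "hull_ht v b =
     (if b \<in> J then Max ((\<lambda>c. ht v c - (sz c - sz b)) ` {c \<in> J. ev c = ev b}) else 0)"

text \<open>One basis vector \<open>e b (h b - 1)\<close> per block of positive height; the form
  \<open>Suc j = h b\<close> leaves out blocks of height 0. For admissible \<open>h\<close> it
  represents the orbit with hull height \<open>h\<close>.\<close>

definition canonical :: "('b \<Rightarrow> nat) \<Rightarrow> 'v" where
  "canonical h = vec_of (\<lambda>b j. if b \<in> J \<and> Suc j = h b then 1 else 0)"

lemma coord_above_ht: "ht v b \<le> j \<Longrightarrow> coord v b j = 0"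
proof -
  have "\<forall>j\<ge>sz b. coord v b j = 0" by (auto intro: coord_outside)
  then have "\<forall>j\<ge>ht v b. coord v b j = 0" unfolding ht_def by (rule LeastI)
  then show "ht v b \<le> j \<Longrightarrow> coord v b j = 0" by blast
qed

lemma ht_leI: "(\<And>j. k \<le> j \<Longrightarrow> coord v b j = 0) \<Longrightarrow> ht v b \<le> k"
  unfolding ht_def by (rule Least_le) blast

lemma ht_le_sz: "ht v b \<le> sz b"
  by (rule ht_leI) (auto intro: coord_outside)

lemma ht_outside: "b \<notin> J \<Longrightarrow> ht v b = 0"
  using ht_leI[of 0 v b] coord_outside by auto

lemma coord_top_ht:
  assumes "0 < ht v b"
  shows "coord v b (ht v b - 1) \<noteq> 0"
proof
  assume *: "coord v b (ht v b - 1) = 0"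
  have "coord v b j = 0" if "ht v b - 1 \<le> j" for j
  proof (cases "j = ht v b - 1")
    case False
    with that show ?thesis by (intro coord_above_ht) linarith
  qed (use * in simp)
  then have "ht v b \<le> ht v b - 1" by (rule ht_leI)
  with assms show False by simp
qed

lemma ht_eqI:
  assumes "\<And>j. k \<le> j \<Longrightarrow> coord v b j = 0" "0 < k \<Longrightarrow> coord v b (k - 1) \<noteq> 0"
  shows "ht v b = k"
proof (rule antisym)
  show "ht v b \<le> k" using assms(1) by (rule ht_leI)
  show "k \<le> ht v b"
  proof (rule ccontr)
    assume "\<not> k \<le> ht v b"
    then have "0 < k" "ht v b \<le> k - 1" by auto
    then show False using assms(2) coord_above_ht by blast
  qed
qed

lemma hull_ht_ge: "b \<in> J \<Longrightarrow> c \<in> J \<Longrightarrow> ev c = ev b \<Longrightarrow> ht v c - (sz c - sz b) \<le> hull_ht v b"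
  unfolding hull_ht_def using finite_J by (auto intro!: Max_ge)

lemma hull_ht_attained:
  assumes "b \<in> J"
  obtains c where "c \<in> J" "ev c = ev b" "hull_ht v b = ht v c - (sz c - sz b)"
proof -
  have "hull_ht v b \<in> (\<lambda>c. ht v c - (sz c - sz b)) ` {c \<in> J. ev c = ev b}"
    unfolding hull_ht_def using assms finite_J by (auto intro!: Max_in)
  then show ?thesis using that by blast
qed

lemma ht_le_hull_ht: "ht v b \<le> hull_ht v b"
  using hull_ht_ge[of b b v] ht_outside[of b v] by (cases "b \<in> J") auto

lemma hull_ht_le:
  assumes "admissible h" "\<And>b. ht v b \<le> h b"
  shows "hull_ht v b \<le> h b"
proof (cases "b \<in> J")
  case True
  then obtain c where c: "c \<in> J" "ev c = ev b" "hull_ht v b = ht v c - (sz c - sz b)"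
    by (rule hull_ht_attained)
  have "ht v c - (sz c - sz b) \<le> h c - (sz c - sz b)"
    using assms(2) by (intro diff_le_mono)
  also have "\<dots> \<le> h b" using assms(1) True c by (auto simp: admissible_def)
  finally show ?thesis using c by simp
qed (simp add: hull_ht_def)

lemma admissible_hull_ht: "admissible (hull_ht v)"
  unfolding admissible_def
proof (intro conjI ballI impI allI)
  fix b assume b: "b \<in> J"
  then obtain c where c: "c \<in> J" "ev c = ev b" "hull_ht v b = ht v c - (sz c - sz b)"
    by (rule hull_ht_attained)
  show "hull_ht v b \<le> sz b" using c ht_le_sz[of v c] by linarith
next
  fix b c assume bc: "b \<in> J" "c \<in> J" "ev c = ev b"
  obtain d where d: "d \<in> J" "ev d = ev c" "hull_ht v c = ht v d - (sz d - sz c)"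
    by (rule hull_ht_attained[OF bc(2)])
  \<comment> \<open>Going from \<open>d\<close> to \<open>b\<close> through \<open>c\<close> lowers
    the height at least as much as going directly.\<close>
  have "ht v d - (sz d - sz b) \<le> hull_ht v b" using bc d by (intro hull_ht_ge) auto
  then show "hull_ht v c - (sz c - sz b) \<le> hull_ht v b" using d(3) by linarith
qed (simp add: hull_ht_def)

lemma hull_ht_eq_ht: "admissible (ht v) \<Longrightarrow> hull_ht v = ht v"
  by (intro ext antisym hull_ht_le ht_le_hull_ht order_refl)

lemma coord_canonical:
  assumes "admissible h"
  shows "coord (canonical h) b j = (if b \<in> J \<and> Suc j = h b then 1 else 0)"
  unfolding canonical_def
  by (rule coord_vec_of) (use assms in \<open>auto simp: admissible_def Suc_le_eq dest!: bspec\<close>)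

lemma ht_canonical: "admissible h \<Longrightarrow> ht (canonical h) = h"
  by (rule ext, rule ht_eqI) (auto simp: coord_canonical admissible_def)

lemma hull_ht_canonical: "admissible h \<Longrightarrow> hull_ht (canonical h) = h"
  using hull_ht_eq_ht ht_canonical by simp

text \<open>
  Write \<open>y\<^sub>j = U (e c j)\<close>. Commutation with \<open>T\<close> says that the coordinates in block \<open>b\<close> satisfy
  \<open>(ev b - ev c) y\<^sub>j[i] + y\<^sub>j[i+1] = y\<^bsub>j-1\<^esub>[i]\<close>. For distinct eigenvalues this forces them to vanish;
  for equal ones the coordinates are constant along diagonals, which leave the index range.
\<close>
lemma coord_centralizer_e:
  assumes "U \<in> C" "admissible h" "c \<in> J" "b \<in> J" "j < h c" "h b \<le> i"
  shows "coord (U (e c j)) b i = 0"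
proof -
  interpret U: Vector_Spaces.linear scl scl U
    using assms(1) by (simp add: mem_centralizer_group_iff)
  have hc: "h c \<le> sz c" using assms by (auto simp: admissible_def)
  have rec: "(ev b - ev c) * coord (U (e c j)) b i + coord (U (e c j)) b (Suc i) =
      (if j = 0 then 0 else coord (U (e c (j - 1))) b i)" if "j < sz c" for i j
  proof -
    have "T (U (e c j)) = U (T (e c j))"
      using assms(1) by (auto simp: mem_centralizer_group_iff fun_eq_iff)
    also have "\<dots> = ev c *\<^sub>C U (e c j) + (if j = 0 then 0 else U (e c (j - 1)))"
      using T_e[OF \<open>c \<in> J\<close> that] by (simp add: U.add U.scale U.zero)
    finally have "coord (T (U (e c j))) b i =
        ev c * coord (U (e c j)) b i + (if j = 0 then 0 else coord (U (e c (j - 1))) b i)"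
      by (simp add: coord_add coord_scale coord_zero)
    then show ?thesis using coord_T[OF \<open>b \<in> J\<close>] by (simp add: algebra_simps)
  qed
  show ?thesis
  proof (cases "ev b = ev c")
    case False
    \<comment> \<open>The outer induction makes the right side of \<open>rec\<close> vanish; the
      inner one descends from above the top of block \<open>b\<close>, where coordinates are zero,
      and cancels the nonzero factor \<open>ev b - ev c\<close>.\<close>
    have "\<forall>i. coord (U (e c j)) b i = 0" if "j < sz c" for j
      using that
    proof (induction j)
      case 0
      show ?case
      proof
        fix i
        show "coord (U (e c 0)) b i = 0"
        proof (induction "sz b - i" arbitrary: i)
          case 0
          then show ?case by (intro coord_outside) auto
        next
          case (Suc k)
          then have "coord (U (e c 0)) b (Suc i) = 0" by simp
          then show ?case using rec[of 0 i] \<open>0 < sz c\<close> False by simp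
        qed
      qed
    next
      case (Suc j)
      show ?case
      proof
        fix i
        show "coord (U (e c (Suc j))) b i = 0"
        proof (induction "sz b - i" arbitrary: i)
          case 0
          then show ?case by (intro coord_outside) auto
        next
          case (Suc k)
          then have "coord (U (e c (Suc j))) b (Suc i) = 0" by simp
          then show ?case using rec[of "Suc j" i] Suc.prems Suc.IH \<open>Suc j < sz c\<close> False
              \<open>j < sz c \<Longrightarrow> \<forall>i. coord (U (e c j)) b i = 0\<close> by simp
        qed
      qed
    qed
    then show ?thesis using assms hc by auto
  next
    case True
    have step: "coord (U (e c (Suc j))) b (Suc i) = coord (U (e c j)) b i" if "Suc j < sz c" for i j
      using rec[OF that] True by simp
    have up: "j + k < sz c \<Longrightarrow> coord (U (e c (j + k))) b (i + k) = coord (U (e c j)) b i" for k i j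
      by (induction k) (auto simp: step)
    show ?thesis
    \<comment> \<open>If \<open>j < i\<close>, the diagonal is followed down to
      \<open>e c 0\<close>, where \<open>rec\<close> kills every coordinate of positive index;
      otherwise it is followed up to the last basis vector of block \<open>c\<close>, where it has
      left block \<open>b\<close>.\<close>
    proof (cases "j < i")
      case True
      have "coord (U (e c j)) b i = coord (U (e c 0)) b (i - j)"
        using up[of 0 j "i - j"] True assms hc by simp
      also have "\<dots> = 0"
        using rec[of 0 "i - j - 1"] \<open>ev b = ev c\<close> True assms hc by (simp add: Suc_diff_Suc)
      finally show ?thesis .
    next
      case False
      define k where "k = sz c - 1 - j"
      have "h c - (sz c - sz b) \<le> h b" using assms True by (auto simp: admissible_def)
      then have "sz b \<le> i + k" using False assms hc unfolding k_def by linarith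
      then have "coord (U (e c (j + k))) b (i + k) = 0" by (intro coord_outside) auto
      then show ?thesis using up[of j k i] assms hc by (simp add: k_def)
    qed
  qed
qed

text \<open>In the basis expansion of \<open>v\<close> each term either has a vanishing coefficient
  or is covered by \<open>coord_centralizer_e\<close>.\<close>

lemma ht_centralizer_le:
  assumes "U \<in> C" "admissible h" "\<And>b. ht v b \<le> h b"
  shows "ht (U v) b \<le> h b"
proof (cases "b \<in> J")
  case True
  interpret U: Vector_Spaces.linear scl scl U
    using assms(1) by (simp add: mem_centralizer_group_iff)
  show ?thesis
  proof (rule ht_leI)
    fix i assume i: "h b \<le> i"
    have "coord (U v) b i = coord (U (vec_of (coord v))) b i" by (simp add: vec_of_coord)
    also have "\<dots> = (\<Sum>p\<in>boxes. coord v (fst p) (snd p) * coord (U (e (fst p) (snd p))) b i)"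
      by (simp add: vec_of_def U.sum U.scale case_prod_beta coord_sum coord_scale)
    also have "\<dots> = 0"
    proof (rule sum.neutral, rule ballI)
      fix p assume p: "p \<in> boxes"
      show "coord v (fst p) (snd p) * coord (U (e (fst p) (snd p))) b i = 0"
      proof (cases "snd p < h (fst p)")
        case True
        then show ?thesis
          using coord_centralizer_e[OF assms(1,2) _ \<open>b \<in> J\<close> True i] p by auto
      next
        case False
        then have "ht v (fst p) \<le> snd p" using assms(3)[of "fst p"] by linarith
        then show ?thesis by (simp add: coord_above_ht)
      qed
    qed
    finally show "coord (U v) b i = 0" .
  qed
qed (simp add: ht_outside)

text \<open>A centralizer element cannot raise the hull height, because \<open>hull_ht v\<close> is
  itself an admissible bound; the same for the inverse gives equality.\<close>

lemma hull_ht_centralizer: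
  assumes "U \<in> C"
  shows "hull_ht (U v) = hull_ht v"
proof (intro ext antisym)
  have le: "hull_ht (W x) b \<le> hull_ht x b" if "W \<in> C" for W x b
    by (rule hull_ht_le[OF admissible_hull_ht ht_centralizer_le[OF that admissible_hull_ht ht_le_hull_ht]])
  fix b
  show "hull_ht (U v) b \<le> hull_ht v b" using assms by (rule le)
  have "inv_into UNIV U (U v) = v"
    using assms by (intro inv_f_f) (auto simp: mem_centralizer_group_iff bij_is_inj)
  then show "hull_ht v b \<le> hull_ht (U v) b" using le[OF C_inv[OF assms], of "U v" b] by simp
qed

text \<open>
  On block \<open>b\<close> the map below is the polynomial in \<open>T - ev b\<close> that sends the basis vector of height
  \<open>ht w b\<close> to the component of \<open>w\<close>; its constant term is the top coordinate of \<open>w\<close>.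
\<close>
lemma canonical_to_vector:
  assumes adm: "admissible (ht w)"
  shows "\<exists>P\<in>C. P (canonical (ht w)) = w"
proof -
  \<comment> \<open>Coefficients of the polynomial on block \<open>b\<close>: the coordinates of
    \<open>w\<close> from the top one downwards. A block of height 0 gets the constant 1, which
    keeps the map injective there.\<close>
  define p where "p b i = (if ht w b = 0 then if i = 0 then 1 else 0
      else if i < ht w b then coord w b (ht w b - 1 - i) else 0)" for b i
  define P where "P x = vec_of (\<lambda>b j. \<Sum>i<sz b. p b i * coord x b (j + i))" for x
  have P: "coord (P x) b j = (\<Sum>i<sz b. p b i * coord x b (j + i))" for x b j
    unfolding P_def by (rule coord_vec_of) (auto intro!: sum.neutral coord_outside)
  have p0: "p b 0 \<noteq> 0" for b
    using coord_top_ht[of w b] by (auto simp: p_def)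
  have "P \<in> C"
  proof (rule centralizerI)
    fix v assume "P v = 0"
    have "ht v b = 0" if "b \<in> J" for b
    proof (rule ccontr)
      assume pos: "ht v b \<noteq> 0"
      \<comment> \<open>At the top nonzero coordinate of \<open>v\<close> only the nonzero constant
        term contributes.\<close>
      define o' where "o' = ht v b - 1"
      have "0 < sz b" using pos ht_le_sz[of v b] by linarith
      have "coord (P v) b o' = (\<Sum>i<sz b. if i = 0 then p b 0 * coord v b o' else 0)"
        unfolding P by (intro sum.cong) (auto simp: o'_def intro!: coord_above_ht)
      also have "\<dots> = p b 0 * coord v b o'" using \<open>0 < sz b\<close> by simp
      also have "\<dots> \<noteq> 0" using p0 coord_top_ht[of v b] pos by (simp add: o'_def)
      finally show False using \<open>P v = 0\<close> by (simp add: coord_zero)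
    qed
    then show "v = 0"
      by (intro coord_eqI) (auto simp: coord_zero intro!: coord_above_ht)
  qed (auto simp: P coord_add coord_scale coord_T sum.distrib sum_distrib_left algebra_simps)
  moreover have "P (canonical (ht w)) = w"
  proof (rule coord_eqI)
    fix b j assume b: "b \<in> J"
    show "coord (P (canonical (ht w))) b j = coord w b j"
    proof (cases "j < ht w b")
      case True
      have "coord (P (canonical (ht w))) b j =
          (\<Sum>i<sz b. if i = ht w b - 1 - j then coord w b j else 0)"
        unfolding P using True b
        by (intro sum.cong) (auto simp: coord_canonical[OF adm] p_def)
      also have "\<dots> = coord w b j" using True ht_le_sz[of w b] by auto
      finally show ?thesis .
    next
      case False
      then have "coord (P (canonical (ht w))) b j = 0"
        unfolding P by (intro sum.neutral) (auto simp: coord_canonical[OF adm])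
      then show ?thesis using False by (simp add: coord_above_ht)
    qed
  qed
  ultimately show ?thesis by blast
qed

text \<open>
  Every block whose height is too small receives a shifted copy of a block that forces the larger
  hull height. Such a source block always has its full height already, so the added map squares to
  zero and the sum is invertible.
\<close>
lemma raise_ht:
  obtains Q where "Q \<in> C" "ht (Q v) = hull_ht v"
proof -
  define bad where "bad b \<longleftrightarrow> b \<in> J \<and> ht v b < hull_ht v b" for b
  have "\<forall>b. \<exists>c. bad b \<longrightarrow>
      c \<in> J \<and> ev c = ev b \<and> hull_ht v b = ht v c - (sz c - sz b) \<and> \<not> bad c"
  proof
    fix b
    show "\<exists>c. bad b \<longrightarrow>
        c \<in> J \<and> ev c = ev b \<and> hull_ht v b = ht v c - (sz c - sz b) \<and> \<not> bad c"
    proof (cases "bad b")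
      case True
      then have "b \<in> J" by (simp add: bad_def)
      then obtain c where c: "c \<in> J" "ev c = ev b" "hull_ht v b = ht v c - (sz c - sz b)"
        by (rule hull_ht_attained)
      \<comment> \<open>Otherwise the block \<open>d\<close> that forces the hull height of
        \<open>c\<close> would force on \<open>b\<close> a height larger than
        \<open>hull_ht v b\<close>.\<close>
      have "\<not> bad c"
      proof
        assume "bad c"
        obtain d where d: "d \<in> J" "ev d = ev c" "hull_ht v c = ht v d - (sz d - sz c)"
          by (rule hull_ht_attained[OF c(1)])
        have "ht v d - (sz d - sz b) \<le> hull_ht v b"
          using \<open>b \<in> J\<close> c d by (intro hull_ht_ge) auto
        then show False using \<open>bad c\<close> True c(3) d(3) unfolding bad_def by linarith
      qed
      with c show ?thesis by blast
    qed blast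
  qed
  then obtain c where c: "\<And>b. bad b \<Longrightarrow> c b \<in> J \<and> ev (c b) = ev b \<and>
      hull_ht v b = ht v (c b) - (sz (c b) - sz b) \<and> \<not> bad (c b)"
    by metis
  define Q where "Q x = vec_of (\<lambda>b j. coord x b j +
      (if bad b then coord x (c b) (j + (sz (c b) - sz b)) else 0))" for x
  have Q: "coord (Q x) b j =
      coord x b j + (if bad b then coord x (c b) (j + (sz (c b) - sz b)) else 0)" for x b j
    unfolding Q_def
  proof (rule coord_vec_of)
    fix b j assume out: "\<not> (b \<in> J \<and> j < sz b)"
    then have "bad b \<Longrightarrow> \<not> j + (sz (c b) - sz b) < sz (c b)" by (auto simp: bad_def)
    then show "coord x b j + (if bad b then coord x (c b) (j + (sz (c b) - sz b)) else 0) = 0"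
      using out by (auto simp: coord_outside)
  qed
  have "Q \<in> C"
  proof (rule centralizerI)
    fix x assume x: "Q x = 0"
    \<comment> \<open>\<open>Q\<close> leaves the blocks that are not bad unchanged, so a kernel
      vector vanishes there, in particular in every source block \<open>c b\<close>; hence it
      vanishes in the bad blocks too.\<close>
    have good: "coord x b j = 0" if "\<not> bad b" for b j
      using Q[of x b j] that x by (simp add: coord_zero)
    have "coord x b j = 0" for b j
      using Q[of x b j] good[of b j] good[of "c b"] c[of b] x
      by (cases "bad b") (auto simp: coord_zero)
    then show "x = 0" by (intro coord_eqI) (simp add: coord_zero)
  qed (use c in \<open>auto simp: Q coord_add coord_scale coord_T algebra_simps\<close>)
  moreover have "ht (Q v) b = hull_ht v b" for b
  proof (cases "bad b")
    case False
    then have "hull_ht v b = ht v b"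
      using ht_le_hull_ht[of v b] by (cases "b \<in> J") (auto simp: bad_def hull_ht_def ht_outside)
    then show ?thesis
      using False coord_top_ht[of v b] by (intro ht_eqI) (auto simp: Q coord_above_ht)
  next
    case True
    then have less: "ht v b < hull_ht v b" by (simp add: bad_def)
    show ?thesis
    proof (rule ht_eqI)
      fix j assume "hull_ht v b \<le> j"
      then have "coord v b j = 0" "coord v (c b) (j + (sz (c b) - sz b)) = 0"
        using less c[OF True] by (auto intro!: coord_above_ht)
      then show "coord (Q v) b j = 0" by (simp add: Q)
    next
      assume "0 < hull_ht v b"
      \<comment> \<open>The hull height is positive, so the truncated subtraction is exact and the
        top coordinate of the source lands at index \<open>hull_ht v b - 1\<close>, where
        \<open>v\<close> itself has 0.\<close>
      have "hull_ht v b - 1 + (sz (c b) - sz b) = ht v (c b) - 1" "0 < ht v (c b)"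
        using less c[OF True] by auto
      moreover have "coord v b (hull_ht v b - 1) = 0" using less by (intro coord_above_ht) auto
      ultimately show "coord (Q v) b (hull_ht v b - 1) \<noteq> 0"
        using True coord_top_ht[of v "c b"] by (simp add: Q)
    qed
  qed
  ultimately show ?thesis using that by blast
qed

text \<open>\<open>Q\<close> raises the heights of \<open>v\<close> to their hull, \<open>P\<close>
  reaches \<open>Q v\<close> from the canonical vector, and the inverse of \<open>Q\<close> returns
  to \<open>v\<close>.\<close>

lemma canonical_in_orbit: "\<exists>U\<in>C. U (canonical (hull_ht v)) = v"
proof -
  obtain Q where Q: "Q \<in> C" "ht (Q v) = hull_ht v" by (rule raise_ht)
  obtain P where P: "P \<in> C" "P (canonical (hull_ht v)) = Q v"
    using canonical_to_vector[of "Q v"] Q(2) admissible_hull_ht by auto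
  have "inv_into UNIV Q (Q v) = v"
    using Q(1) by (intro inv_f_f) (auto simp: mem_centralizer_group_iff bij_is_inj)
  then have "(inv_into UNIV Q \<circ> P) (canonical (hull_ht v)) = v" using P(2) by simp
  then show ?thesis using C_comp[OF C_inv[OF Q(1)] P(1)] by blast
qed

text \<open>\<open>hull_ht\<close> is constant on orbits, and vectors with the same value are linked
  through their common canonical vector.\<close>

lemma orbit_eq: "orbit (centralizer_group scl T) (\<lambda>U. U) v = {w. hull_ht w = hull_ht v}"
proof (intro Set.set_eqI iffI)
  fix w assume "w \<in> orbit (centralizer_group scl T) (\<lambda>U. U) v"
  then show "w \<in> {w. hull_ht w = hull_ht v}"
    by (auto simp: orbit_def hull_ht_centralizer)
next
  fix w assume "w \<in> {w. hull_ht w = hull_ht v}"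
  then have eq: "hull_ht w = hull_ht v" by simp
  obtain U where U: "U \<in> C" "U (canonical (hull_ht v)) = v" using canonical_in_orbit by blast
  obtain W where W: "W \<in> C" "W (canonical (hull_ht v)) = w"
    using canonical_in_orbit[of w] eq by auto
  have "inv_into UNIV U v = canonical (hull_ht v)"
    using U by (intro inv_f_eq) (auto simp: mem_centralizer_group_iff bij_is_inj)
  then have "w = (W \<circ> inv_into UNIV U) v" using W by simp
  then show "w \<in> orbit (centralizer_group scl T) (\<lambda>U. U) v"
    unfolding orbit_def using C_comp[OF W(1) C_inv[OF U(1)]] by blast
qed

lemma centralizer_orbits_eq:
  "centralizer_orbits scl T = (\<lambda>h. {w. hull_ht w = h}) ` {h. admissible h}"
proof -
  have "centralizer_orbits scl T = (\<lambda>v. {w. hull_ht w = hull_ht v}) ` UNIV"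
    by (auto simp: centralizer_orbits_def orbits_def orbit_eq)
  also have "\<dots> = (\<lambda>h. {w. hull_ht w = h}) ` {h. admissible h}"
    by (auto simp: image_iff admissible_hull_ht) (metis hull_ht_canonical)
  finally show ?thesis .
qed

lemma inj_on_orbit_of_ht: "inj_on (\<lambda>h. {w. hull_ht w = h}) {h. admissible h}"
  by (rule inj_onI) (metis (mono_tags, lifting) hull_ht_canonical mem_Collect_eq)

section \<open>Closures and dimensions of orbits\<close>

text \<open>Each condition on the right is closed in the standard topology, which places the orbit
  closure inside the span.\<close>

lemma mem_span_e_iff:
  assumes "admissible h"
  shows "v \<in> span (case_prod e ` Sigma J (\<lambda>b. {..<h b})) \<longleftrightarrow> (\<forall>b\<in>J. \<forall>j\<ge>h b. coord v b j = 0)"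
proof
  assume "v \<in> span (case_prod e ` Sigma J (\<lambda>b. {..<h b}))"
  then show "\<forall>b\<in>J. \<forall>j\<ge>h b. coord v b j = 0"
  proof (induction rule: span_induct_alt)
    case base
    then show ?case by (simp add: coord_zero)
  next
    case (step a x y)
    then obtain b j where bj: "b \<in> J" "j < h b" "x = e b j" by auto
    then have "j < sz b" using assms by (auto simp: admissible_def)
    then show ?case using step bj by (auto simp: coord_add coord_scale coord_e)
  qed
next
  assume *: "\<forall>b\<in>J. \<forall>j\<ge>h b. coord v b j = 0"
  have "(\<Sum>(b, j)\<in>boxes. coord v b j *\<^sub>C e b j) \<in> span (case_prod e ` Sigma J (\<lambda>b. {..<h b}))"
  proof (rule span_sum, clarify)
    fix b j assume b: "b \<in> J"
    show "coord v b j *\<^sub>C e b j \<in> span (case_prod e ` Sigma J (\<lambda>b. {..<h b}))"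
    proof (cases "j < h b")
      case True
      then show ?thesis using b by (intro span_scale span_base) force
    next
      case False
      then show ?thesis using b * by (simp add: span_zero)
    qed
  qed
  then show "v \<in> span (case_prod e ` Sigma J (\<lambda>b. {..<h b}))"
    using vec_of_coord[of v] by (simp add: vec_of_def)
qed

lemma topspace_standard: "topspace (standard_topology scl) = UNIV"
proof -
  have "UNIV \<in> {f -` S |f S. Vector_Spaces.linear scl (*) f \<and> open (S :: complex set)}"
    by (rule CollectI) (metis linear_coord open_UNIV vimage_UNIV)
  then show ?thesis unfolding standard_topology_def topology_generated_by_topspace by blast
qed

lemma closedin_coord_zero: "closedin (standard_topology scl) {v. coord v b j = 0}"
proof -
  have "openin (standard_topology scl) ((\<lambda>v. coord v b j) -` (- {0}))"
    unfolding standard_topology_def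
    by (rule topology_generated_by_Basis) (use linear_coord in blast)
  moreover have "UNIV - {v. coord v b j = 0} = (\<lambda>v. coord v b j) -` (- {0})" by auto
  ultimately show ?thesis by (simp add: closedin_def topspace_standard)
qed

text \<open>
  Perturbing the canonical vector by any \<open>e b j\<close> with \<open>j < h b\<close> stays in its orbit, so the orbit
  already spans.
\<close>
lemma orbit_dim_eq:
  assumes adm: "admissible h"
  shows "orbit_dim scl {w. hull_ht w = h} = (\<Sum>b\<in>J. h b)"
proof -
  let ?B = "case_prod e ` Sigma J (\<lambda>b. {..<h b})" and ?X = "{w. hull_ht w = h}"
  let ?cl = "standard_topology scl closure_of ?X"
  have sub: "Sigma J (\<lambda>b. {..<h b}) \<subseteq> boxes" using adm by (auto simp: admissible_def)
  have "?B \<subseteq> span ?X"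
  proof clarify
    fix b j assume bj: "b \<in> J" "j < h b"
    then have "j < sz b" using adm by (auto simp: admissible_def)
    let ?w = "canonical h + e b j"
    have "coord ?w c i = (if c \<in> J \<and> Suc i = h c then 1 else 0) + (if c = b \<and> i = j then 1 else 0)"
      for c i using \<open>j < sz b\<close> bj by (simp add: coord_add coord_canonical[OF adm] coord_e)
    \<comment> \<open>The top coordinate in block \<open>b\<close> stays 1 or, if
      \<open>j = h b - 1\<close>, becomes 2; no height changes.\<close>
    then have "ht ?w c = h c" for c
      using bj adm by (intro ht_eqI) (auto simp: admissible_def)
    then have "hull_ht ?w = h" using hull_ht_eq_ht[of ?w] adm by (metis ext)
    moreover have "hull_ht (canonical h) = h" using adm by (rule hull_ht_canonical)
    ultimately have "?w - canonical h \<in> span ?X" by (intro span_diff span_base) auto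
    then show "e b j \<in> span ?X" by simp
  qed
  moreover have "?X \<subseteq> ?cl" by (rule closure_of_subset) (simp add: topspace_standard)
  ultimately have "?B \<subseteq> span ?cl" using span_mono by blast
  moreover have "?cl \<subseteq> span ?B"
  proof -
    have "?X \<subseteq> {v. coord v b j = 0}" if "h b \<le> j" for b j
    proof clarify
      fix w assume "h = hull_ht w"
      then show "coord w b j = 0"
        using that ht_le_hull_ht[of w b] by (intro coord_above_ht) simp
    qed
    then have "?cl \<subseteq> {v. coord v b j = 0}" if "h b \<le> j" for b j
      using that by (intro closure_of_minimal closedin_coord_zero)
    then show ?thesis unfolding mem_span_e_iff[OF adm] subset_eq by blast
  qed
  ultimately have "span ?B = span ?cl"
    by (metis span_mono span_span subset_antisym)
  moreover have "independent ?B" using independent_e sub by (rule independent_mono[OF _ image_mono])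
  ultimately have "dim ?cl = card ?B" by (rule dim_eq_card)
  also have "\<dots> = card (Sigma J (\<lambda>b. {..<h b}))"
    by (rule card_image) (rule inj_on_subset[OF inj_e sub])
  also have "\<dots> = (\<Sum>b\<in>J. h b)" using finite_J by simp
  finally show ?thesis by (simp add: orbit_dim_def)
qed

text \<open>An eigenvector compared with its image at its top nonzero coordinate in some block
  yields the \<open>ev\<close> of that block; conversely, a nonempty block contains the eigenvector
  \<open>e b 0\<close>.\<close>

lemma Spec_eq:
  assumes "\<And>b. b \<in> J \<Longrightarrow> 0 < sz b"
  shows "Spec scl T = ev ` J"
proof (intro Set.set_eqI iffI)
  fix \<mu> assume "\<mu> \<in> Spec scl T"
  then obtain v where v: "v \<noteq> 0" "T v = \<mu> *\<^sub>C v" by (auto simp: Spec_def)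
  then obtain b where b: "b \<in> J" "ht v b \<noteq> 0"
    using coord_eqI[of v 0] coord_above_ht[of v] by (metis coord_zero le0)
  define j where "j = ht v b - 1"
  have "\<mu> * coord v b j = ev b * coord v b j + coord v b (Suc j)"
    using coord_T[OF b(1), of v j] v(2) by (simp add: coord_scale)
  moreover have "coord v b (Suc j) = 0" by (rule coord_above_ht) (simp add: j_def)
  moreover have "coord v b j \<noteq> 0" using coord_top_ht b(2) by (simp add: j_def)
  ultimately show "\<mu> \<in> ev ` J" using b by auto
next
  fix \<mu> assume "\<mu> \<in> ev ` J"
  then obtain b where b: "b \<in> J" "\<mu> = ev b" by auto
  have "coord (e b 0) b 0 = 1" using b assms by (simp add: coord_e)
  then have "e b 0 \<noteq> 0" by (metis coord_zero zero_neq_one)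
  moreover have "T (e b 0) = \<mu> *\<^sub>C e b 0" using T_e[of b 0] b assms by simp
  ultimately show "\<mu> \<in> Spec scl T" by (auto simp: Spec_def)
qed

end


section \<open>Counting admissible height functions\<close>

text \<open>Telescoping in the naturals, where monotonicity makes every difference exact. The
  inequality is carried along for the induction step.\<close>

lemma sum_increments:
  fixes f :: "nat \<Rightarrow> nat"
  assumes "\<And>k. i < k \<Longrightarrow> k \<le> j \<Longrightarrow> f (k - 1) \<le> f k" "i \<le> j"
  shows "f i \<le> f j \<and> (\<Sum>k\<in>{i<..j}. f k - f (k - 1)) = f j - f i"
  using assms(2,1)
proof (induction j rule: dec_induct)
  case (step j)
  then have IH: "f i \<le> f j" "(\<Sum>k\<in>{i<..j}. f k - f (k - 1)) = f j - f i" by auto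
  have "{i<..Suc j} = insert (Suc j) {i<..j}" using step.hyps by auto
  then show ?case using IH step.prems[of "Suc j"] step.hyps by auto
qed auto

text \<open>
  The size of block \<open>b\<close> is the \<open>r b\<close>-th smallest one \<open>s (ev b) (r b)\<close> of its eigenvalue, and
  \<open>s \<mu> 0 = 0\<close>. An admissible height function is determined by its own increments along each
  sequence \<open>s \<mu>\<close>, which range freely between zero and the increments of \<open>s \<mu>\<close>.
\<close>
lemma (in jordan_space) card_admissible:
  fixes r :: "'b \<Rightarrow> nat" and N :: "complex \<Rightarrow> nat" and s :: "complex \<Rightarrow> nat \<Rightarrow> nat"
  assumes s0: "\<And>\<mu>. s \<mu> 0 = 0"
    and s_less: "\<And>\<mu> i j. i < j \<Longrightarrow> j \<le> N \<mu> \<Longrightarrow> s \<mu> i < s \<mu> j"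
    and r: "\<And>b. b \<in> J \<Longrightarrow> 1 \<le> r b \<and> r b \<le> N (ev b) \<and> s (ev b) (r b) = sz b"
    and rep_ex: "\<And>\<mu> k. \<mu> \<in> ev ` J \<Longrightarrow> 1 \<le> k \<Longrightarrow> k \<le> N \<mu> \<Longrightarrow> \<exists>b\<in>J. ev b = \<mu> \<and> r b = k"
  shows "finite {h. admissible h \<and> (\<Sum>b\<in>J. h b) = n} \<and>
    card {h. admissible h \<and> (\<Sum>b\<in>J. h b) = n} =
      coeff (\<Prod>\<mu>\<in>ev ` J. \<Prod>k=1..N \<mu>. \<Sum>i=0..s \<mu> k - s \<mu> (k - 1).
        monom (1::nat) (i * card {b \<in> J. ev b = \<mu> \<and> k \<le> r b})) n"
proof -
  \<comment> \<open>\<open>K\<close> indexes the factors of the product, \<open>B\<close> gives the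
    range of the increment in each and \<open>M\<close> its weight. An element of \<open>D\<close>
    is a family of increments, which \<open>F\<close> sums up to a height function.\<close>
  define K where "K = Sigma (ev ` J) (\<lambda>\<mu>. {1..N \<mu>})"
  define B where "B = (\<lambda>(\<mu>, k). {0..s \<mu> k - s \<mu> (k - 1)})"
  define M where "M = (\<lambda>(\<mu>, k). card {b \<in> J. ev b = \<mu> \<and> k \<le> r b})"
  define D where "D = PiE K B"
  define F where "F \<delta> = (\<lambda>b. if b \<in> J then \<Sum>k\<in>{0<..r b}. \<delta> (ev b, k) else 0)" for \<delta> :: "complex \<times> nat \<Rightarrow> nat"
  have finK: "finite K" unfolding K_def using finite_J by auto
  have finD: "finite D" unfolding D_def B_def using finK by (intro finite_PiE) auto
  have \<delta>_le: "\<delta> (\<mu>, k) \<le> s \<mu> k - s \<mu> (k - 1)" if "\<delta> \<in> D" "\<mu> \<in> ev ` J" "0 < k" "k \<le> N \<mu>" for \<delta> \<mu> k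
    using that PiE_mem[of \<delta> K B "(\<mu>, k)"] by (auto simp: D_def K_def B_def)
  have sum_\<delta>_le: "(\<Sum>k\<in>{i<..j}. \<delta> (\<mu>, k)) \<le> s \<mu> j - s \<mu> i"
    if "\<delta> \<in> D" "\<mu> \<in> ev ` J" "i \<le> j" "j \<le> N \<mu>" for \<delta> \<mu> i j
  proof -
    have "(\<Sum>k\<in>{i<..j}. \<delta> (\<mu>, k)) \<le> (\<Sum>k\<in>{i<..j}. s \<mu> k - s \<mu> (k - 1))"
      using that by (intro sum_mono \<delta>_le) auto
    also have "\<dots> = s \<mu> j - s \<mu> i"
      using that s_less by (intro conjunct2[OF sum_increments]) (auto intro!: less_imp_le)
    finally show ?thesis .
  qed
  have F_adm: "admissible (F \<delta>)" if \<delta>: "\<delta> \<in> D" for \<delta>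
    unfolding admissible_def
  proof (intro conjI ballI impI allI)
    fix b assume "b \<in> J"
    then show "F \<delta> b \<le> sz b"
      using sum_\<delta>_le[OF \<delta>, of "ev b" 0 "r b"] r[of b] by (auto simp: F_def s0)
  next
    fix b c assume bc: "b \<in> J" "c \<in> J" "ev c = ev b"
    show "F \<delta> c - (sz c - sz b) \<le> F \<delta> b"
    proof (cases "r c \<le> r b")
      case True
      then have "F \<delta> c \<le> F \<delta> b" using bc by (auto simp: F_def intro!: sum_mono2)
      then show ?thesis by linarith
    next
      case False
      then have "{0<..r c} = {0<..r b} \<union> {r b<..r c}" by auto
      then have "F \<delta> c = F \<delta> b + (\<Sum>k\<in>{r b<..r c}. \<delta> (ev b, k))"
        using bc by (simp add: F_def sum.union_disjoint ivl_disj_int)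
      moreover have "(\<Sum>k\<in>{r b<..r c}. \<delta> (ev b, k)) \<le> sz c - sz b"
        using sum_\<delta>_le[OF \<delta>, of "ev b" "r b" "r c"] r[of b] r[of c] bc False by auto
      ultimately show ?thesis by linarith
    qed
  qed (simp add: F_def)
  have F_inj: "inj_on F D"
  proof (rule inj_onI)
    fix \<delta> \<epsilon> assume *: "\<delta> \<in> D" "\<epsilon> \<in> D" "F \<delta> = F \<epsilon>"
    \<comment> \<open>Every rank is attained by a block, so equal height functions have equal
      partial sums; consecutive ones recover each increment.\<close>
    have eq: "(\<Sum>k\<in>{0<..k}. \<delta> (\<mu>, k)) = (\<Sum>k\<in>{0<..k}. \<epsilon> (\<mu>, k))"
      if \<mu>: "\<mu> \<in> ev ` J" "k \<le> N \<mu>" for \<mu> k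
    proof (cases "k = 0")
      case False
      then obtain b where b: "b \<in> J" "ev b = \<mu>" "r b = k" using rep_ex[of \<mu> k] \<mu> by auto
      then show ?thesis using fun_cong[OF *(3), of b] by (simp add: F_def)
    qed simp
    show "\<delta> = \<epsilon>"
    proof (rule PiE_ext)
      show "\<delta> \<in> PiE K B" "\<epsilon> \<in> PiE K B" using * by (auto simp: D_def)
      fix p assume "p \<in> K"
      then obtain \<mu> k where p: "p = (\<mu>, Suc k)" "\<mu> \<in> ev ` J" "Suc k \<le> N \<mu>"
        by (cases p, cases "snd p") (auto simp: K_def)
      have "{0<..Suc k} = insert (Suc k) {0<..k}" by auto
      then show "\<delta> p = \<epsilon> p" using eq[of \<mu> k] eq[of \<mu> "Suc k"] p by simp
    qed
  qed
  have F_surj: "h \<in> F ` D" if adm: "admissible h" for h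
  proof -
    \<comment> \<open>Any block of rank \<open>k\<close> will do: admissibility in both directions
      gives equal heights to blocks of equal size and eigenvalue.\<close>
    define rep where "rep \<mu> k = (SOME b. b \<in> J \<and> ev b = \<mu> \<and> r b = k)" for \<mu> k
    define g where "g \<mu> k = (if k = 0 then 0 else h (rep \<mu> k))" for \<mu> k
    define \<delta> where "\<delta> = restrict (\<lambda>(\<mu>, k). g \<mu> k - g \<mu> (k - 1)) K"
    have rep: "rep \<mu> k \<in> J \<and> ev (rep \<mu> k) = \<mu> \<and> r (rep \<mu> k) = k"
      if "\<mu> \<in> ev ` J" "1 \<le> k" "k \<le> N \<mu>" for \<mu> k
      unfolding rep_def by (rule someI_ex) (use rep_ex[OF that] in blast)
    have h_rule: "h c - (sz c - sz b) \<le> h b" if "b \<in> J" "c \<in> J" "ev c = ev b" for b c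
      using adm that by (auto simp: admissible_def)
    have g: "g \<mu> (k - 1) \<le> g \<mu> k \<and> g \<mu> k - g \<mu> (k - 1) \<le> s \<mu> k - s \<mu> (k - 1)"
      if \<mu>: "\<mu> \<in> ev ` J" and k: "0 < k" "k \<le> N \<mu>" for \<mu> k
    proof (cases "k = 1")
      case True
      then show ?thesis using adm rep[of \<mu> k] r[of "rep \<mu> k"] \<mu> k
        by (auto simp: g_def s0 admissible_def)
    next
      case False
      have a: "rep \<mu> k \<in> J" "ev (rep \<mu> k) = \<mu>" "sz (rep \<mu> k) = s \<mu> k"
        using rep[of \<mu> k] r[of "rep \<mu> k"] \<mu> k by auto
      have b: "rep \<mu> (k - 1) \<in> J" "ev (rep \<mu> (k - 1)) = \<mu>" "sz (rep \<mu> (k - 1)) = s \<mu> (k - 1)"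
        using rep[of \<mu> "k - 1"] r[of "rep \<mu> (k - 1)"] \<mu> k False by auto
      have "s \<mu> (k - 1) < s \<mu> k" using k by (intro s_less) auto
      then have "h (rep \<mu> (k - 1)) \<le> h (rep \<mu> k)"
        "h (rep \<mu> k) - (s \<mu> k - s \<mu> (k - 1)) \<le> h (rep \<mu> (k - 1))"
        using h_rule[of "rep \<mu> k" "rep \<mu> (k - 1)"] h_rule[of "rep \<mu> (k - 1)" "rep \<mu> k"] a b
        by simp_all
      moreover have "g \<mu> k = h (rep \<mu> k)" "g \<mu> (k - 1) = h (rep \<mu> (k - 1))"
        using False k by (auto simp: g_def)
      ultimately show ?thesis by linarith
    qed
    have "\<delta> \<in> D"
      unfolding D_def \<delta>_def B_def using g by (auto simp: K_def)
    moreover have "F \<delta> = h"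
    proof
      fix b
      show "F \<delta> b = h b"
      proof (cases "b \<in> J")
        case True
        note rb = r[OF True]
        have "F \<delta> b = (\<Sum>k\<in>{0<..r b}. g (ev b) k - g (ev b) (k - 1))"
          using True rb by (auto simp: F_def \<delta>_def K_def intro!: sum.cong)
        also have "\<dots> = g (ev b) (r b) - g (ev b) 0"
          using True rb g by (intro conjunct2[OF sum_increments]) auto
        also have "\<dots> = h (rep (ev b) (r b))" using rb by (simp add: g_def)
        also have "\<dots> = h b"
        proof -
          have c: "rep (ev b) (r b) \<in> J" "ev (rep (ev b) (r b)) = ev b" "sz (rep (ev b) (r b)) = sz b"
            using rep[of "ev b" "r b"] r[of "rep (ev b) (r b)"] rb True by auto
          then show ?thesis
            using h_rule[of b "rep (ev b) (r b)"] h_rule[of "rep (ev b) (r b)" b] True by simp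
        qed
        finally show ?thesis .
      qed (use adm in \<open>auto simp: F_def admissible_def\<close>)
    qed
    ultimately show ?thesis by blast
  qed
  \<comment> \<open>Double counting: the increment at \<open>(\<mu>, k)\<close> enters the heights
    of exactly the blocks of \<mu> with rank at least \<open>k\<close>.\<close>
  have F_sum: "(\<Sum>b\<in>J. F \<delta> b) = (\<Sum>p\<in>K. \<delta> p * M p)" for \<delta>
  proof -
    have "(\<Sum>b\<in>J. F \<delta> b) = (\<Sum>b\<in>J. \<Sum>p\<in>K. if fst p = ev b \<and> snd p \<le> r b then \<delta> p else 0)"
    proof (rule sum.cong[OF refl])
      fix b assume b: "b \<in> J"
      have "F \<delta> b = (\<Sum>p\<in>Pair (ev b) ` {0<..r b}. \<delta> p)"
        using b by (simp add: F_def sum.reindex inj_on_def)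
      also have "Pair (ev b) ` {0<..r b} = {p \<in> K. fst p = ev b \<and> snd p \<le> r b}"
        using b r[OF b] by (force simp: K_def)
      also have "(\<Sum>p\<in>\<dots>. \<delta> p) = (\<Sum>p\<in>K. if fst p = ev b \<and> snd p \<le> r b then \<delta> p else 0)"
        using finK by (rule sum.inter_filter)
      finally show "F \<delta> b = (\<Sum>p\<in>K. if fst p = ev b \<and> snd p \<le> r b then \<delta> p else 0)" .
    qed
    also have "\<dots> = (\<Sum>p\<in>K. \<Sum>b\<in>J. if fst p = ev b \<and> snd p \<le> r b then \<delta> p else 0)"
      by (rule sum.swap)
    also have "\<dots> = (\<Sum>p\<in>K. \<delta> p * M p)"
    proof (rule sum.cong[OF refl])
      fix p
      have "(\<Sum>b\<in>J. if fst p = ev b \<and> snd p \<le> r b then \<delta> p else 0) =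
          (\<Sum>b\<in>{b \<in> J. fst p = ev b \<and> snd p \<le> r b}. \<delta> p)"
        using finite_J by (rule sum.inter_filter[symmetric])
      also have "{b \<in> J. fst p = ev b \<and> snd p \<le> r b} = {b \<in> J. ev b = fst p \<and> snd p \<le> r b}" by auto
      finally show "(\<Sum>b\<in>J. if fst p = ev b \<and> snd p \<le> r b then \<delta> p else 0) = \<delta> p * M p"
        by (simp add: M_def case_prod_beta)
    qed
    finally show ?thesis .
  qed
  have image: "{h. admissible h \<and> (\<Sum>b\<in>J. h b) = n} = F ` {\<delta> \<in> D. (\<Sum>p\<in>K. \<delta> p * M p) = n}"
  proof (intro subset_antisym subsetI)
    fix h assume h: "h \<in> {h. admissible h \<and> (\<Sum>b\<in>J. h b) = n}"
    then obtain \<delta> where "\<delta> \<in> D" "h = F \<delta>" using F_surj by blast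
    then show "h \<in> F ` {\<delta> \<in> D. (\<Sum>p\<in>K. \<delta> p * M p) = n}" using h F_sum[of \<delta>] by simp
  next
    fix h assume "h \<in> F ` {\<delta> \<in> D. (\<Sum>p\<in>K. \<delta> p * M p) = n}"
    then show "h \<in> {h. admissible h \<and> (\<Sum>b\<in>J. h b) = n}" using F_adm F_sum by auto
  qed
  have "(\<Prod>\<mu>\<in>ev ` J. \<Prod>k=1..N \<mu>. \<Sum>i=0..s \<mu> k - s \<mu> (k - 1).
        monom (1::nat) (i * card {b \<in> J. ev b = \<mu> \<and> k \<le> r b})) =
      (\<Prod>p\<in>K. \<Sum>i\<in>B p. monom 1 (i * M p))"
    unfolding K_def using finite_J by (subst prod.Sigma) (auto simp: B_def M_def case_prod_beta)
  \<comment> \<open>Expanding the product picks one term per factor, that is, one element of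
    \<open>D\<close>.\<close>
  also have "\<dots> = (\<Sum>\<delta>\<in>D. \<Prod>p\<in>K. monom 1 (\<delta> p * M p))"
    unfolding D_def using finK by (rule prod_sum_PiE) (auto simp: B_def)
  also have "\<dots> = (\<Sum>\<delta>\<in>D. monom 1 (\<Sum>p\<in>K. \<delta> p * M p))"
  proof (rule sum.cong[OF refl])
    fix \<delta>
    show "(\<Prod>p\<in>K. monom (1::nat) (\<delta> p * M p)) = monom 1 (\<Sum>p\<in>K. \<delta> p * M p)"
      using finK by (induction K rule: finite_induct) (auto simp: mult_monom simp del: One_nat_def)
  qed
  finally have "coeff (\<Prod>\<mu>\<in>ev ` J. \<Prod>k=1..N \<mu>. \<Sum>i=0..s \<mu> k - s \<mu> (k - 1).
        monom (1::nat) (i * card {b \<in> J. ev b = \<mu> \<and> k \<le> r b})) n =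
      (\<Sum>\<delta>\<in>D. if (\<Sum>p\<in>K. \<delta> p * M p) = n then 1 else 0)"
    by (simp add: coeff_sum del: One_nat_def)
  also have "\<dots> = card {\<delta> \<in> D. (\<Sum>p\<in>K. \<delta> p * M p) = n}"
    using finD by (simp flip: sum.inter_filter del: One_nat_def)
  also have "\<dots> = card {h. admissible h \<and> (\<Sum>b\<in>J. h b) = n}"
    unfolding image by (rule card_image[symmetric]) (rule inj_on_subset[OF F_inj], blast)
  finally show ?thesis using finD by (simp add: image)
qed

text \<open>Finiteness is transferred separately because \<open>card\<close> is also 0 on infinite
  sets.\<close>

lemma (in jordan_space) card_orbits_of_dim:
  "finite {X \<in> centralizer_orbits scl T. orbit_dim scl X = n} =
     finite {h. admissible h \<and> (\<Sum>b\<in>J. h b) = n}"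
  "card {X \<in> centralizer_orbits scl T. orbit_dim scl X = n} =
     card {h. admissible h \<and> (\<Sum>b\<in>J. h b) = n}"
proof -
  let ?A = "{h. admissible h \<and> (\<Sum>b\<in>J. h b) = n}"
  have eq: "{X \<in> centralizer_orbits scl T. orbit_dim scl X = n} = (\<lambda>h. {w. hull_ht w = h}) ` ?A"
    by (auto simp: centralizer_orbits_eq orbit_dim_eq)
  have "inj_on (\<lambda>h. {w. hull_ht w = h}) ?A"
    by (rule inj_on_subset[OF inj_on_orbit_of_ht]) blast
  then show "finite {X \<in> centralizer_orbits scl T. orbit_dim scl X = n} = finite ?A"
    "card {X \<in> centralizer_orbits scl T. orbit_dim scl X = n} = card ?A"
    unfolding eq by (simp_all add: finite_image_iff card_image)
qed


section \<open>Existence of a Jordan basis\<close>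

text \<open>Translates positions in the block-diagonal matrix into pairs of block and inner index;
  asking only for some bijection avoids explicit offsets.\<close>

lemma jordan_matrix_positions:
  "\<exists>\<phi>. bij_betw \<phi> (Sigma {..<length nas} (\<lambda>b. {..<fst (nas ! b)})) {..<sum_list (map fst nas)} \<and>
     (\<forall>p\<in>Sigma {..<length nas} (\<lambda>b. {..<fst (nas ! b)}).
      \<forall>q\<in>Sigma {..<length nas} (\<lambda>b. {..<fst (nas ! b)}).
        jordan_matrix nas $$ (\<phi> p, \<phi> q) =
          (if fst p \<noteq> fst q then 0 else if snd p = snd q then snd (nas ! fst q)
           else if Suc (snd p) = snd q then 1 else 0))"
proof (induction nas)
  case Nil
  then show ?case by (auto simp: bij_betw_def)
next
  case (Cons na nas)
  obtain n a where na: "na = (n, a)" by force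
  let ?I = "Sigma {..<length nas} (\<lambda>b. {..<fst (nas ! b)})"
  let ?I' = "Sigma {..<length (na # nas)} (\<lambda>b. {..<fst ((na # nas) ! b)})"
  let ?m = "sum_list (map fst nas)"
  obtain \<psi> where bij: "bij_betw \<psi> ?I {..<?m}"
    and \<psi>: "\<And>p q. p \<in> ?I \<Longrightarrow> q \<in> ?I \<Longrightarrow> jordan_matrix nas $$ (\<psi> p, \<psi> q) =
          (if fst p \<noteq> fst q then 0 else if snd p = snd q then snd (nas ! fst q)
           else if Suc (snd p) = snd q then 1 else 0)"
    using Cons.IH by blast
  define \<phi> where "\<phi> p = (case fst p of 0 \<Rightarrow> snd p | Suc b \<Rightarrow> n + \<psi> (b, snd p))" for p
  have less: "\<psi> p < ?m" if "p \<in> ?I" for p using bij that by (auto simp: bij_betw_def)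
  have cases: "(\<exists>j<n. p = (0, j)) \<or> (\<exists>b j. p = (Suc b, j) \<and> (b, j) \<in> ?I)" if "p \<in> ?I'" for p
    using that by (cases p, cases "fst p") (auto simp: na)
  have "inj_on \<phi> ?I'"
  proof (rule inj_onI)
    fix p q assume *: "p \<in> ?I'" "q \<in> ?I'" "\<phi> p = \<phi> q"
    have "inj_on \<psi> ?I" using bij by (simp add: bij_betw_def)
    then show "p = q" using cases[OF *(1)] cases[OF *(2)] *(3)
      by (auto simp: \<phi>_def inj_on_eq_iff[OF \<open>inj_on \<psi> ?I\<close>])
  qed
  moreover have "\<phi> ` ?I' = {..<n + ?m}"
  proof (intro subset_antisym subsetI)
    fix x assume "x \<in> \<phi> ` ?I'"
    then obtain p where p: "p \<in> ?I'" "x = \<phi> p" by blast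
    then show "x \<in> {..<n + ?m}" using cases[OF p(1)] less by (auto simp: \<phi>_def)
  next
    fix x assume x: "x \<in> {..<n + ?m}"
    show "x \<in> \<phi> ` ?I'"
    proof (cases "x < n")
      case True
      then show ?thesis by (intro image_eqI[of _ _ "(0, x)"]) (auto simp: \<phi>_def na)
    next
      case False
      then have "x - n \<in> \<psi> ` ?I" using x bij by (auto simp: bij_betw_def)
      then obtain b j where "(b, j) \<in> ?I" "x - n = \<psi> (b, j)" by auto
      then show ?thesis using False by (intro image_eqI[of _ _ "(Suc b, j)"]) (auto simp: \<phi>_def)
    qed
  qed
  moreover have "jordan_matrix (na # nas) $$ (\<phi> p, \<phi> q) =
          (if fst p \<noteq> fst q then 0 else if snd p = snd q then snd ((na # nas) ! fst q)
           else if Suc (snd p) = snd q then 1 else 0)" if "p \<in> ?I'" "q \<in> ?I'" for p q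
    using cases[OF that(1)] cases[OF that(2)]
    by (auto simp: na jordan_matrix_Cons \<phi>_def less \<psi>)
  ultimately show ?case by (intro exI[of _ \<phi>]) (simp add: bij_betw_def na)
qed

lemma mult_mat_index_sum:
  assumes "A \<in> carrier_mat n n" "B \<in> carrier_mat n n" "i < n" "j < n"
  shows "(A * B) $$ (i, j) = (\<Sum>k<n. A $$ (i, k) * B $$ (k, j))"
  using assms by (simp add: scalar_prod_def lessThan_atLeast0)

text \<open>The columns of the similarity matrix \<open>P\<close>, read in the basis
  \<open>bs\<close>, form a Jordan basis.\<close>

lemma jordan_nf_imp_jordan_space:
  fixes scl :: "complex \<Rightarrow> 'v::ab_group_add \<Rightarrow> 'v"
  assumes "Vector_Spaces.vector_space scl" and lin: "Vector_Spaces.linear scl scl T"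
    and bs: "is_ordered_basis scl bs" and A: "matrix_wrt scl bs T A" and nf: "jordan_nf A nas"
  shows "\<exists>e. jordan_space scl T {..<length nas} (\<lambda>b. fst (nas ! b)) (\<lambda>b. snd (nas ! b)) e"
proof -
  interpret Vector_Spaces.vector_space scl by fact
  have fd: "finite_dimensional_vector_space scl (set bs)"
    by unfold_locales (use bs in \<open>auto simp: is_ordered_basis_def\<close>)
  interpret finite_dimensional_vector_space scl "set bs" by (rule fd)
  interpret T: Vector_Spaces.linear scl scl T by (rule lin)
  define N where "N = length bs"
  let ?J = "jordan_matrix nas" and ?I = "Sigma {..<length nas} (\<lambda>b. {..<fst (nas ! b)})"
  have Ac: "A \<in> carrier_mat N N"
    and TA: "\<And>j. j < N \<Longrightarrow> T (bs ! j) = (\<Sum>i<N. scl (A $$ (i, j)) (bs ! i))"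
    using A by (auto simp: matrix_wrt_def N_def)
  obtain m P Q where sim: "{A, ?J, P, Q} \<subseteq> carrier_mat m m" "P * Q = 1\<^sub>m m" "Q * P = 1\<^sub>m m"
      "A = P * ?J * Q"
    using nf similar_matD unfolding jordan_nf_def by blast
  then have "m = N" using Ac by auto
  note sim = sim[unfolded this]
  have c: "P \<in> carrier_mat N N" "Q \<in> carrier_mat N N" "?J \<in> carrier_mat N N" using sim by auto
  have "A * P = P * ?J * (Q * P)" unfolding sim(4)
    by (rule assoc_mult_mat[of _ N N _ N _ N]) (use c in auto)
  also have "\<dots> = P * ?J"
    unfolding sim(3) by (rule right_mult_one_mat[OF mult_carrier_mat[OF c(1,3)]])
  finally have AP: "A * P = P * ?J" .
  have size: "sum_list (map fst nas) = N" using c(3) by (metis carrier_matD(1) jordan_matrix_dim(1))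
  define f where "f j = (\<Sum>i<N. scl (P $$ (i, j)) (bs ! i))" for j
  have Tf: "T (f j) = (\<Sum>i<N. scl (?J $$ (i, j)) (f i))" if j: "j < N" for j
  proof -
    have "T (f j) = (\<Sum>i<N. \<Sum>k<N. scl (A $$ (k, i) * P $$ (i, j)) (bs ! k))"
      unfolding f_def T.sum T.scale
      by (intro sum.cong) (auto simp: TA scale_sum_right mult.commute)
    also have "\<dots> = (\<Sum>k<N. scl (\<Sum>i<N. A $$ (k, i) * P $$ (i, j)) (bs ! k))"
      by (subst sum.swap) (simp add: scale_sum_left)
    also have "\<dots> = (\<Sum>k<N. scl (\<Sum>i<N. P $$ (k, i) * ?J $$ (i, j)) (bs ! k))"
      using AP mult_mat_index_sum[OF Ac c(1) _ j] mult_mat_index_sum[OF c(1,3) _ j]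
      by (intro sum.cong) auto
    also have "\<dots> = (\<Sum>i<N. \<Sum>k<N. scl (P $$ (k, i) * ?J $$ (i, j)) (bs ! k))"
      by (subst sum.swap) (simp add: scale_sum_left)
    also have "\<dots> = (\<Sum>i<N. scl (?J $$ (i, j)) (f i))"
      by (simp add: f_def scale_sum_right mult.commute)
    finally show ?thesis .
  qed
  \<comment> \<open>The inverse matrix \<open>Q\<close> expresses \<open>bs\<close> through
    \<open>f\<close>, so \<open>f\<close> spans; with as many members as the dimension it is a
    basis.\<close>
  have bs_f: "bs ! k = (\<Sum>j<N. scl (Q $$ (j, k)) (f j))" if k: "k < N" for k
  proof -
    have "(\<Sum>j<N. scl (Q $$ (j, k)) (f j)) = (\<Sum>j<N. \<Sum>i<N. scl (P $$ (i, j) * Q $$ (j, k)) (bs ! i))"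
      by (simp add: f_def scale_sum_right mult.commute)
    also have "\<dots> = (\<Sum>i<N. scl (\<Sum>j<N. P $$ (i, j) * Q $$ (j, k)) (bs ! i))"
      by (subst sum.swap) (simp add: scale_sum_left)
    also have "\<dots> = (\<Sum>i<N. if i = k then bs ! i else 0)"
    proof (rule sum.cong[OF refl])
      fix i assume "i \<in> {..<N}"
      then have i: "i < N" by simp
      have "(\<Sum>j<N. P $$ (i, j) * Q $$ (j, k)) = 1\<^sub>m N $$ (i, k)"
        using mult_mat_index_sum[OF c(1,2) i k] sim(2) by simp
      then show "scl (\<Sum>j<N. P $$ (i, j) * Q $$ (j, k)) (bs ! i) = (if i = k then bs ! i else 0)"
        using i k by simp
    qed
    also have "\<dots> = bs ! k" using k by simp
    finally show ?thesis by simp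
  qed
  have "set bs \<subseteq> span (f ` {..<N})"
  proof
    fix x assume "x \<in> set bs"
    then obtain k where k: "k < N" "x = bs ! k" by (auto simp: in_set_conv_nth N_def)
    show "x \<in> span (f ` {..<N})"
      unfolding k(2) bs_f[OF k(1)] by (intro span_sum span_scale span_base imageI) auto
  qed
  then have span_f: "span (f ` {..<N}) = UNIV"
    using span_mono[of "set bs" "span (f ` {..<N})"] span_Basis by (auto simp: span_span)
  have dimN: "dim UNIV = N"
    using bs by (simp add: N_def is_ordered_basis_def distinct_card)
  have "dim UNIV \<le> card (f ` {..<N})"
    by (rule dim_le_card) (auto simp: span_f)
  then have cardf: "card (f ` {..<N}) = N"
    using dimN card_image_le[of "{..<N}" f] by simp
  then have inj_f: "inj_on f {..<N}" by (intro eq_card_imp_inj_on) auto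
  have indep_f: "independent (f ` {..<N})"
    by (rule card_le_dim_spanning[of _ UNIV]) (auto simp: span_f cardf dimN simp del: dim_UNIV)
  obtain \<phi> where bij: "bij_betw \<phi> ?I {..<N}"
    and \<phi>: "\<And>p q. p \<in> ?I \<Longrightarrow> q \<in> ?I \<Longrightarrow> ?J $$ (\<phi> p, \<phi> q) =
          (if fst p \<noteq> fst q then 0 else if snd p = snd q then snd (nas ! fst q)
           else if Suc (snd p) = snd q then 1 else 0)"
    using jordan_matrix_positions[of nas] unfolding size by blast
  define e where "e b j = f (\<phi> (b, j))" for b j
  have e: "case_prod e = f \<circ> \<phi>" by (auto simp: e_def fun_eq_iff)
  have image_e: "case_prod e ` ?I = f ` {..<N}"
    unfolding e using bij by (metis bij_betw_def image_comp)
  have T_e: "T (e b j) = scl (snd (nas ! b)) (e b j) + (if j = 0 then 0 else e b (j - 1))"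
    if bj: "b \<in> {..<length nas}" "j < fst (nas ! b)" for b j
  proof -
    have q: "(b, j) \<in> ?I" using bj by simp
    have "T (e b j) = (\<Sum>i<N. scl (?J $$ (i, \<phi> (b, j))) (f i))"
      unfolding e_def using bij q by (intro Tf) (auto simp: bij_betw_def)
    also have "\<dots> = (\<Sum>p\<in>?I. scl (?J $$ (\<phi> p, \<phi> (b, j))) (f (\<phi> p)))"
      using bij by (rule sum.reindex_bij_betw[symmetric])
    \<comment> \<open>The column of \<open>(b, j)\<close> has at most two nonzero entries: the
      diagonal one and, for positive \<open>j\<close>, the 1 just above it.\<close>
    also have "\<dots> = (\<Sum>p\<in>?I. (if p = (b, j) then scl (snd (nas ! b)) (e b j) else 0) +
        (if 0 < j \<and> p = (b, j - 1) then e b (j - 1) else 0))"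
      using q by (intro sum.cong) (auto simp: \<phi> e_def)
    also have "\<dots> = scl (snd (nas ! b)) (e b j) + (if j = 0 then 0 else e b (j - 1))"
      using bj by (cases "j = 0") (auto simp: sum.distrib)
    finally show ?thesis .
  qed
  have "inj_on (case_prod e) ?I"
    unfolding e using bij inj_f by (intro comp_inj_on) (auto simp: bij_betw_def)
  then have "jordan_space scl T {..<length nas} (\<lambda>b. fst (nas ! b)) (\<lambda>b. snd (nas ! b)) e"
    using lin indep_f span_f T_e
    by (intro jordan_space.intro jordan_space_axioms.intro vector_space_axioms)
      (simp_all add: image_e)
  then show ?thesis by blast
qed

text \<open>The characteristic polynomial of a complex matrix splits, so a Jordan list exists and
  \<open>SOME\<close> in \<open>jordan_blocks\<close> returns one.\<close>

lemma jordan_blocks_witness: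
  fixes scl :: "complex \<Rightarrow> 'v::ab_group_add \<Rightarrow> 'v"
  assumes "finite_dimensional_vector_space scl B" "Vector_Spaces.linear scl scl T"
  shows "\<exists>bs A. is_ordered_basis scl bs \<and> matrix_wrt scl bs T A \<and>
    jordan_nf A (jordan_blocks scl T)"
proof -
  interpret finite_dimensional_vector_space scl B by fact
  obtain bs where bs: "set bs = B" "distinct bs"
    using finite_distinct_list[OF finite_Basis] by blast
  have basis: "is_ordered_basis scl bs"
    using bs independent_Basis span_Basis by (simp add: is_ordered_basis_def)
  let ?N = "length bs"
  define A where "A = mat ?N ?N (\<lambda>(i, j). representation B (T (bs ! j)) (bs ! i))"
  have Ac: "A \<in> carrier_mat ?N ?N" by (simp add: A_def)
  have "T (bs ! j) = (\<Sum>i<?N. scl (A $$ (i, j)) (bs ! i))" if "j < ?N" for j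
  proof -
    have "T (bs ! j) = (\<Sum>x\<in>B. scl (representation B (T (bs ! j)) x) x)"
      by (rule sum_representation_eq[symmetric])
        (use independent_Basis span_Basis finite_Basis in auto)
    also have "\<dots> = (\<Sum>i<?N. scl (representation B (T (bs ! j)) (bs ! i)) (bs ! i))"
      using bs by (intro sum.reindex_bij_betw[symmetric]) (auto intro!: bij_betw_nth)
    also have "\<dots> = (\<Sum>i<?N. scl (A $$ (i, j)) (bs ! i))"
      using that by (intro sum.cong) (auto simp: A_def)
    finally show ?thesis .
  qed
  then have "matrix_wrt scl bs T A" using Ac by (simp add: matrix_wrt_def)
  moreover obtain nas where "jordan_nf A nas"
    using char_poly_factorized[OF Ac] jordan_nf_exists[OF Ac] by blast
  ultimately have "\<exists>nas bs A. is_ordered_basis scl bs \<and> matrix_wrt scl bs T A \<and> jordan_nf A nas"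
    using basis by blast
  then show ?thesis unfolding jordan_blocks_def by (rule someI_ex)
qed

section \<open>The orbit count from the list of Jordan blocks\<close>

theorem theorem6p1:
  fixes scl :: "complex \<Rightarrow> 'v::ab_group_add \<Rightarrow> 'v"
    and Basis :: "'v set"
    and T :: "'v \<Rightarrow> 'v"
    and n :: nat
  assumes "finite_dimensional_vector_space scl Basis"
    and "Vector_Spaces.linear scl scl T"
  shows "finite {X \<in> centralizer_orbits scl T. orbit_dim scl X = n} \<and>
         card {X \<in> centralizer_orbits scl T. orbit_dim scl X = n} =
           coeff (\<Prod>\<mu>\<in>Spec scl T. eigen_poly scl T \<mu>) n"
proof -
  interpret finite_dimensional_vector_space scl Basis by fact
  define nas where "nas = jordan_blocks scl T"
  define sz where "sz b = fst (nas ! b)" for b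
  define ev where "ev b = snd (nas ! b)" for b
  \<comment> \<open>Blocks are positions in the list, so repeated entries count separately.\<close>
  define J where "J = {..<length nas}"
  obtain bs A where bsA: "is_ordered_basis scl bs" "matrix_wrt scl bs T A" "jordan_nf A nas"
    using jordan_blocks_witness[OF assms] unfolding nas_def by blast
  then obtain e where "jordan_space scl T J sz ev e"
    using jordan_nf_imp_jordan_space[OF vector_space_axioms assms(2)]
    unfolding J_def sz_def[abs_def] ev_def[abs_def] by blast
  then interpret jordan_space scl T J sz ev e .
  have pos: "0 < sz b" if "b \<in> J" for b
    using bsA(3) that by (force simp: jordan_nf_def J_def sz_def)
  have nth: "nas ! b = (i, \<mu>) \<longleftrightarrow> ev b = \<mu> \<and> sz b = i" for b i \<mu>
    by (auto simp: ev_def sz_def prod_eq_iff)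
  have sizes: "block_sizes scl T \<mu> = sz ` {b \<in> J. ev b = \<mu>}" for \<mu>
    by (fastforce simp: block_sizes_def in_set_conv_nth nth J_def simp flip: nas_def)
  define N where "N \<mu> = card (block_sizes scl T \<mu>)" for \<mu>
  \<comment> \<open>The value 0 at \<open>k = 0\<close> makes the first increment a difference like
    all others.\<close>
  define s where "s \<mu> k = (if k = 0 then 0 else nth_size scl T \<mu> k)" for \<mu> k
  have fin: "finite (block_sizes scl T \<mu>)" for \<mu> using finite_J by (simp add: sizes)
  have s_eq: "s \<mu> (Suc i) = sorted_list_of_set (block_sizes scl T \<mu>) ! i" for \<mu> i
    by (simp add: s_def nth_size_def)
  have s_mem: "s \<mu> k \<in> block_sizes scl T \<mu>" if "1 \<le> k" "k \<le> N \<mu>" for \<mu> k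
  proof -
    have "sorted_list_of_set (block_sizes scl T \<mu>) ! (k - 1) \<in> set (sorted_list_of_set (block_sizes scl T \<mu>))"
      using that fin by (intro nth_mem) (auto simp: N_def)
    then show ?thesis using that fin by (simp add: s_def nth_size_def)
  qed
  have s_less: "s \<mu> i < s \<mu> j" if "i < j" "j \<le> N \<mu>" for \<mu> i j
  proof (cases i)
    case 0
    have "s \<mu> j \<in> sz ` {b \<in> J. ev b = \<mu>}" using s_mem[of j \<mu>] that sizes by auto
    then have "0 < s \<mu> j" using pos by auto
    then show ?thesis using 0 by (simp add: s_def)
  next
    case (Suc i')
    obtain j' where j: "j = Suc j'" using \<open>i < j\<close> by (cases j) auto
    have "sorted_wrt (<) (sorted_list_of_set (block_sizes scl T \<mu>))" by simp
    then show ?thesis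
      unfolding Suc j s_eq by (rule sorted_wrt_nth_less) (use Suc j that in \<open>auto simp: N_def\<close>)
  qed
  have "\<exists>k. 1 \<le> k \<and> k \<le> N (ev b) \<and> s (ev b) k = sz b" if "b \<in> J" for b
  proof -
    have "sz b \<in> set (sorted_list_of_set (block_sizes scl T (ev b)))"
      using that fin by (auto simp: sizes)
    then obtain i where "i < N (ev b)" "sorted_list_of_set (block_sizes scl T (ev b)) ! i = sz b"
      by (auto simp: in_set_conv_nth N_def)
    then show ?thesis by (intro exI[of _ "Suc i"]) (auto simp: s_eq)
  qed
  then obtain r where r: "\<And>b. b \<in> J \<Longrightarrow> 1 \<le> r b \<and> r b \<le> N (ev b) \<and> s (ev b) (r b) = sz b"
    by metis
  have s_inj: "i = j" if "s \<mu> i = s \<mu> j" "i \<le> N \<mu>" "j \<le> N \<mu>" for \<mu> i j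
    using s_less[of i j \<mu>] s_less[of j i \<mu>] that by (metis less_irrefl linorder_neqE_nat)
  have rep_ex: "\<exists>b\<in>J. ev b = \<mu> \<and> r b = k" if "\<mu> \<in> ev ` J" "1 \<le> k" "k \<le> N \<mu>" for \<mu> k
  proof -
    obtain b where b: "b \<in> J" "ev b = \<mu>" "s \<mu> k = sz b"
      using s_mem[OF \<open>1 \<le> k\<close> \<open>k \<le> N \<mu>\<close>] by (auto simp: sizes)
    then have "r b = k" using r[of b] \<open>k \<le> N \<mu>\<close> s_inj[of \<mu> "r b" k] by auto
    then show ?thesis using b by blast
  qed
  have mult: "block_mult scl T \<mu> (s \<mu> k) = card {b \<in> J. ev b = \<mu> \<and> r b = k}"
    if "1 \<le> k" "k \<le> N \<mu>" for \<mu> k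
  proof -
    have "block_mult scl T \<mu> (s \<mu> k) = card {b. b < length nas \<and> nas ! b = (s \<mu> k, \<mu>)}"
      unfolding block_mult_def nas_def[symmetric] count_list_eq_length_filter length_filter_conv_card
      by (metis (no_types, lifting))
    also have "{b. b < length nas \<and> nas ! b = (s \<mu> k, \<mu>)} = {b \<in> J. ev b = \<mu> \<and> r b = k}"
    proof (intro Set.set_eqI iffI)
      fix b assume "b \<in> {b. b < length nas \<and> nas ! b = (s \<mu> k, \<mu>)}"
      then have "b \<in> J" "ev b = \<mu>" "sz b = s \<mu> k" by (auto simp: nth J_def)
      then show "b \<in> {b \<in> J. ev b = \<mu> \<and> r b = k}" using r[of b] that s_inj[of \<mu> "r b" k] by auto
    next
      fix b assume "b \<in> {b \<in> J. ev b = \<mu> \<and> r b = k}"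
      then show "b \<in> {b. b < length nas \<and> nas ! b = (s \<mu> k, \<mu>)}"
        using r[of b] by (auto simp: nth J_def)
    qed
    finally show ?thesis .
  qed
  have tail: "tail_mult scl T \<mu> k = card {b \<in> J. ev b = \<mu> \<and> k \<le> r b}"
    if "1 \<le> k" for \<mu> k
  proof -
    have "tail_mult scl T \<mu> k = (\<Sum>l=k..N \<mu>. card {b \<in> J. ev b = \<mu> \<and> r b = l})"
      unfolding tail_mult_def N_def[symmetric]
    proof (rule sum.cong[OF refl])
      fix l assume "l \<in> {k..N \<mu>}"
      then show "block_mult scl T \<mu> (nth_size scl T \<mu> l) = card {b \<in> J. ev b = \<mu> \<and> r b = l}"
        using mult[of l \<mu>] that by (simp add: s_def)
    qed
    \<comment> \<open>The blocks of rank at least \<open>k\<close> are partitioned by their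
      rank.\<close>
    also have "\<dots> = card (\<Union>l\<in>{k..N \<mu>}. {b \<in> J. ev b = \<mu> \<and> r b = l})"
      using finite_J by (intro card_UN_disjoint[symmetric]) auto
    also have "(\<Union>l\<in>{k..N \<mu>}. {b \<in> J. ev b = \<mu> \<and> r b = l}) = {b \<in> J. ev b = \<mu> \<and> k \<le> r b}"
      using r by auto
    finally show ?thesis .
  qed
  have "eigen_poly scl T \<mu> = (\<Prod>k=1..N \<mu>. \<Sum>i=0..s \<mu> k - s \<mu> (k - 1).
        monom 1 (i * card {b \<in> J. ev b = \<mu> \<and> k \<le> r b}))" for \<mu>
    unfolding eigen_poly_def N_def[symmetric]
  proof (rule prod.cong[OF refl])
    fix k assume "k \<in> {1..N \<mu>}"
    then have "increment scl T \<mu> k = s \<mu> k - s \<mu> (k - 1)" "1 \<le> k"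
      by (auto simp: increment_def s_def)
    then show "(\<Sum>i=0..increment scl T \<mu> k. monom 1 (i * tail_mult scl T \<mu> k)) =
        (\<Sum>i=0..s \<mu> k - s \<mu> (k - 1). monom 1 (i * card {b \<in> J. ev b = \<mu> \<and> k \<le> r b}))"
      by (simp add: tail)
  qed
  moreover have "Spec scl T = ev ` J" using pos by (rule Spec_eq)
  ultimately show ?thesis
    using card_admissible[of s N r n] s_less r rep_ex by (simp add: card_orbits_of_dim s_def)
qed

end
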